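(* If a countable graph $H$ contains $\mathcal{G}_4$, then $H$ has unbounded vertex degrees, i.e. there is no $\Delta\in\mathbb{N}$ such that every vertex of $H$ has degree at most $\Delta$.
   Context: All graphs are simple, connected and countable. $\mathcal{G}_4$ denotes the class of all connected graphs which do not contain a star with $4$ leaves as a subgraph; equivalently, the class of all connected graphs in which all vertex degrees are strictly less than $4$. A graph $H$ contains a graph class $\mathcal{G}$ if every $G\in\mathcal{G}$ is isomorphic to a (not necessarily induced) subgraph of $H$. *)

theory Defs
  imports "HOL-Library.Countable_Set" "HOL-Library.Extended_Nat"
begin

record 'a graph =
  verts :: "'a set"
  edges :: "'a set set"

definition simple_graph :: "'a graph \<Rightarrow> bool" where
  "simple_graph G \<longleftrightarrow> (\<forall>e\<in>edges G. e \<subseteq> verts G \<and> card e = 2)"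

definition adjacent :: "'a graph \<Rightarrow> 'a \<Rightarrow> 'a \<Rightarrow> bool" where
  "adjacent G u v \<longleftrightarrow> {u, v} \<in> edges G"

definition connected_graph :: "'a graph \<Rightarrow> bool" where
  "connected_graph G \<longleftrightarrow>
     verts G \<noteq> {} \<and> (\<forall>u\<in>verts G. \<forall>v\<in>verts G. (adjacent G)\<^sup>*\<^sup>* u v)"

definition countable_graph :: "'a graph \<Rightarrow> bool" where
  "countable_graph G \<longleftrightarrow> countable (verts G)"

definition neighbours :: "'a graph \<Rightarrow> 'a \<Rightarrow> 'a set" where
  "neighbours G v = {u. adjacent G v u}"

(* Vertices may have infinite degree, where card would return 0. *)
definition degree :: "'a graph \<Rightarrow> 'a \<Rightarrow> enat" where
  "degree G v = (if finite (neighbours G v) then enat (card (neighbours G v)) else \<infinity>)"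

definition subgraph :: "'a graph \<Rightarrow> 'a graph \<Rightarrow> bool" where
  "subgraph G H \<longleftrightarrow> simple_graph G \<and> verts G \<subseteq> verts H \<and> edges G \<subseteq> edges H"

definition isomorphic :: "'a graph \<Rightarrow> 'b graph \<Rightarrow> bool" where
  "isomorphic G H \<longleftrightarrow> (\<exists>f. bij_betw f (verts G) (verts H) \<and>
     (\<forall>u\<in>verts G. \<forall>v\<in>verts G. adjacent G u v \<longleftrightarrow> adjacent H (f u) (f v)))"

definition contains_graph :: "'a graph \<Rightarrow> 'b graph \<Rightarrow> bool" where
  "contains_graph H G \<longleftrightarrow> (\<exists>H'. subgraph H' H \<and> isomorphic G H')"

definition contains_class :: "'a graph \<Rightarrow> 'b graph set \<Rightarrow> bool" where
  "contains_class H \<G> \<longleftrightarrow> (\<forall>G\<in>\<G>. contains_graph H G)"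

definition star :: "nat \<Rightarrow> nat graph" where
  "star k = \<lparr>verts = {0..k}, edges = {{0, i} | i. i \<in> {1..k}}\<rparr>"

definition star_free_graphs :: "nat \<Rightarrow> 'a graph set" where
  "star_free_graphs k =
     {G. simple_graph G \<and> connected_graph G \<and> countable_graph G \<and> \<not> contains_graph G (star k)}"

(* A set of graphs has a fixed vertex type. Since graphs are countable, vertex sets
   included in nat represent every isomorphism type; see contains_G4_any_type below. *)
definition G4 :: "nat graph set" where
  "G4 = star_free_graphs 4"

lemma contains_graphI:
  assumes G: "simple_graph G" and H: "simple_graph H"
    and inj: "inj_on f (verts G)" and im: "f ` verts G \<subseteq> verts H"
    and adj: "\<And>u v. adjacent G u v \<Longrightarrow> adjacent H (f u) (f v)"
  shows "contains_graph H G"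
proof -
  let ?H = "\<lparr>verts = f ` verts G, edges = (\<lambda>e. f ` e) ` edges G\<rparr>"
  have sub: "e \<subseteq> verts G" "card e = 2" if "e \<in> edges G" for e
    using G that by (auto simp: simple_graph_def)
  have "subgraph ?H H"
    unfolding subgraph_def simple_graph_def
  proof (intro conjI ballI)
    fix e assume "e \<in> edges ?H"
    then obtain d where d: "d \<in> edges G" "e = f ` d" by auto
    show "e \<subseteq> verts ?H" using d sub by auto
    show "card e = 2" using d sub inj by (metis card_image inj_on_subset)
  next
    show "verts ?H \<subseteq> verts H" using im by simp
    show "edges ?H \<subseteq> edges H"
    proof
      fix e assume "e \<in> edges ?H"
      then obtain d where d: "d \<in> edges G" "e = f ` d" by auto
      then obtain a b where "d = {a, b}" using sub(2) by (meson card_2_iff)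
      then show "e \<in> edges H" using adj[of a b] d by (simp add: adjacent_def)
    qed
  qed
  moreover have "isomorphic G ?H"
    unfolding isomorphic_def
  proof (intro exI conjI ballI)
    show "bij_betw f (verts G) (verts ?H)" using inj by (simp add: bij_betw_def)
    fix u v assume uv: "u \<in> verts G" "v \<in> verts G"
    show "adjacent G u v \<longleftrightarrow> adjacent ?H (f u) (f v)"
    proof
      assume "adjacent G u v"
      then have "f ` {u, v} \<in> (\<lambda>e. f ` e) ` edges G" unfolding adjacent_def by (rule imageI)
      then show "adjacent ?H (f u) (f v)" by (simp add: adjacent_def)
    next
      assume "adjacent ?H (f u) (f v)"
      then obtain d where d: "d \<in> edges G" "f ` {u, v} = f ` d"
        by (auto simp: adjacent_def)
      then have "{u, v} = d" using uv inj sub(1)[OF d(1)]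
        by (metis empty_subsetI inj_on_image_eq_iff insert_subset)
      then show "adjacent G u v" using d by (simp add: adjacent_def)
    qed
  qed
  ultimately show ?thesis unfolding contains_graph_def by blast
qed

lemma adjacent_verts: "simple_graph G \<Longrightarrow> adjacent G u v \<Longrightarrow> u \<in> verts G \<and> v \<in> verts G"
  by (auto simp: simple_graph_def adjacent_def)

lemma contains_graphE:
  assumes "simple_graph G" "contains_graph H G"
  obtains f where "inj_on f (verts G)" "f ` verts G \<subseteq> verts H"
    "\<And>u v. adjacent G u v \<Longrightarrow> adjacent H (f u) (f v)"
proof -
  obtain H' f where H': "subgraph H' H" "bij_betw f (verts G) (verts H')"
    "\<forall>u\<in>verts G. \<forall>v\<in>verts G. adjacent G u v \<longleftrightarrow> adjacent H' (f u) (f v)"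
    using assms(2) unfolding contains_graph_def isomorphic_def by blast
  show ?thesis
  proof
    show "inj_on f (verts G)" "f ` verts G \<subseteq> verts H"
      using H' by (auto simp: bij_betw_def subgraph_def)
    fix u v assume "adjacent G u v"
    then have "adjacent H' (f u) (f v)" using H'(3) adjacent_verts[OF assms(1)] by blast
    then show "adjacent H (f u) (f v)" using H'(1) by (auto simp: subgraph_def adjacent_def)
  qed
qed

lemma simple_star: "simple_graph (star k)"
  by (auto simp: simple_graph_def star_def)

lemma adjacent_star:
  "adjacent (star k) u v \<longleftrightarrow> (u = 0 \<and> v \<in> {1..k}) \<or> (v = 0 \<and> u \<in> {1..k})"
  by (auto simp: adjacent_def star_def doubleton_eq_iff)

lemma contains_star_iff:
  assumes G: "simple_graph G" and k: "k \<ge> 1"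
  shows "contains_graph G (star k) \<longleftrightarrow> (\<exists>v\<in>verts G. enat k \<le> degree G v)"
proof
  assume "contains_graph G (star k)"
  then obtain f where f: "inj_on f (verts (star k))" "f ` verts (star k) \<subseteq> verts G"
    "\<And>u v. adjacent (star k) u v \<Longrightarrow> adjacent G (f u) (f v)"
    using contains_graphE[OF simple_star] by metis
  have im: "f ` {1..k} \<subseteq> neighbours G (f 0)"
    using f(3) by (auto simp: neighbours_def adjacent_star)
  have "inj_on f {1..k}" using f(1) by (rule inj_on_subset) (auto simp: star_def)
  then have "card (f ` {1..k}) = k" by (simp add: card_image)
  then have "enat k \<le> degree G (f 0)"
    using card_mono[OF _ im] by (auto simp: degree_def)
  moreover have "f 0 \<in> verts G" using f(2) by (auto simp: star_def)
  ultimately show "\<exists>v\<in>verts G. enat k \<le> degree G v" by blast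
next
  assume "\<exists>v\<in>verts G. enat k \<le> degree G v"
  then obtain v where v: "v \<in> verts G" "enat k \<le> degree G v" by blast
  have "\<exists>S. S \<subseteq> neighbours G v \<and> card S = k \<and> finite S"
  proof (cases "finite (neighbours G v)")
    case True
    then show ?thesis using v(2)
      by (metis degree_def enat_ord_simps(1) obtain_subset_with_card_n)
  next
    case False
    then show ?thesis by (metis infinite_arbitrarily_large)
  qed
  then obtain S where S: "S \<subseteq> neighbours G v" "card S = k" "finite S" by blast
  obtain g where g: "bij_betw g {1..k} S"
    using S by (metis card_atLeastAtMost diff_Suc_1 finite_atLeastAtMost finite_same_card_bij)
  let ?f = "\<lambda>i. if i = 0 then v else g i"
  have gS: "adjacent G v (g i)" "g i \<noteq> v" "g i \<in> verts G" if "i \<in> {1..k}" for i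
  proof -
    have "g i \<in> S" using g that by (auto simp: bij_betw_def)
    then show a: "adjacent G v (g i)" using S(1) by (auto simp: neighbours_def)
    then show "g i \<noteq> v" using G by (force simp: adjacent_def simple_graph_def)
    show "g i \<in> verts G" using a adjacent_verts[OF G] by blast
  qed
  show "contains_graph G (star k)"
  proof (rule contains_graphI[OF simple_star G, where f = ?f])
    have g_inj: "inj_on g {1..k}" using g by (simp add: bij_betw_def)
    show "inj_on ?f (verts (star k))"
    proof (rule inj_onI)
      fix i j assume "i \<in> verts (star k)" "j \<in> verts (star k)" and e: "?f i = ?f j"
      then have i: "i = 0 \<or> i \<in> {1..k}" and j: "j = 0 \<or> j \<in> {1..k}"
        by (auto simp: star_def)
      show "i = j"
      proof (cases "i = 0 \<or> j = 0")
        case True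
        then show ?thesis using e i j gS(2)[of i] gS(2)[of j] by (auto split: if_splits)
      next
        case False
        then show ?thesis using e i j inj_onD[OF g_inj, of i j] by simp
      qed
    qed
    show "?f ` verts (star k) \<subseteq> verts G" using v(1) gS(3) by (auto simp: star_def)
    show "adjacent G (?f a) (?f b)" if "adjacent (star k) a b" for a b
      using that gS(1) unfolding adjacent_star by (auto simp: adjacent_def insert_commute)
  qed
qed

lemma star_free_graphs_iff:
  assumes "k \<ge> 1"
  shows "G \<in> star_free_graphs k \<longleftrightarrow>
    simple_graph G \<and> connected_graph G \<and> countable_graph G \<and> (\<forall>v\<in>verts G. degree G v < enat k)"
  using contains_star_iff[OF _ assms, of G]
  unfolding star_free_graphs_def mem_Collect_eq by (meson not_le)

lemma contains_graph_trans:
  assumes "simple_graph G" "simple_graph H" "simple_graph K"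
    and "contains_graph H G" "contains_graph K H"
  shows "contains_graph K G"
proof -
  obtain f where f: "inj_on f (verts G)" "f ` verts G \<subseteq> verts H"
    "\<And>u v. adjacent G u v \<Longrightarrow> adjacent H (f u) (f v)"
    using contains_graphE[OF assms(1,4)] by metis
  obtain g where g: "inj_on g (verts H)" "g ` verts H \<subseteq> verts K"
    "\<And>u v. adjacent H u v \<Longrightarrow> adjacent K (g u) (g v)"
    using contains_graphE[OF assms(2,5)] by metis
  show ?thesis
  proof (rule contains_graphI[OF assms(1,3)])
    show "inj_on (g \<circ> f) (verts G)"
      using f(1) inj_on_subset[OF g(1) f(2)] by (rule comp_inj_on)
    show "(g \<circ> f) ` verts G \<subseteq> verts K" using f(2) g(2) by fastforce
    show "adjacent K ((g \<circ> f) u) ((g \<circ> f) v)" if "adjacent G u v" for u v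
      using g(3)[OF f(3)[OF that]] by simp
  qed
qed

lemma contains_G4_any_type:
  fixes H :: "'a graph"
  assumes H: "simple_graph H" and c: "contains_class H G4"
  shows "contains_class H (star_free_graphs 4 :: 'b graph set)"
  unfolding contains_class_def
proof
  fix G :: "'b graph" assume "G \<in> star_free_graphs 4"
  then have G: "simple_graph G" "connected_graph G" "countable (verts G)"
    "\<not> contains_graph G (star 4)"
    by (auto simp: star_free_graphs_def countable_graph_def)
  obtain f :: "'b \<Rightarrow> nat" where f: "inj_on f (verts G)" using G(3) by (auto simp: countable_def)
  let ?N = "\<lparr>verts = f ` verts G, edges = (\<lambda>e. f ` e) ` edges G\<rparr>"
  let ?g = "inv_into (verts G) f"
  have sub: "e \<subseteq> verts G" "card e = 2" if "e \<in> edges G" for e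
    using G(1) that by (auto simp: simple_graph_def)
  have adj: "adjacent ?N (f u) (f v)" if "adjacent G u v" for u v
  proof -
    have "f ` {u, v} \<in> (\<lambda>e. f ` e) ` edges G" using that unfolding adjacent_def by (rule imageI)
    then show ?thesis by (simp add: adjacent_def)
  qed
  have N: "simple_graph ?N"
    unfolding simple_graph_def using sub f
    by (auto simp: card_image inj_on_subset[OF f])
  have GN: "contains_graph ?N G"
    by (rule contains_graphI[OF G(1) N f]) (simp, rule adj)
  have NG: "contains_graph G ?N"
  proof (rule contains_graphI[OF N G(1), where f = ?g])
    show "inj_on ?g (verts ?N)" by (simp add: inj_on_inv_into)
    show "?g ` verts ?N \<subseteq> verts G" using f by auto
    fix u v assume "adjacent ?N u v"
    then obtain d where d: "d \<in> edges G" "{u, v} = f ` d" by (auto simp: adjacent_def)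
    have "?g ` {u, v} = d" using d(2) sub(1)[OF d(1)] f by (metis inv_into_image_cancel)
    then show "adjacent G (?g u) (?g v)" using d(1) by (simp add: adjacent_def)
  qed
  have "connected_graph ?N"
  proof -
    have "(adjacent ?N)\<^sup>*\<^sup>* (f u) (f v)" if "(adjacent G)\<^sup>*\<^sup>* u v" for u v
    proof (use that in induction)
      case (step y z)
      then show ?case using adj by (metis rtranclp.rtrancl_into_rtrancl)
    qed simp
    then show ?thesis using G(2) by (auto simp: connected_graph_def)
  qed
  moreover have "\<not> contains_graph ?N (star 4)"
    using contains_graph_trans[OF simple_star N G(1) _ NG] G(4) by blast
  ultimately have "?N \<in> G4"
    using N by (simp add: G4_def star_free_graphs_def countable_graph_def)
  then have "contains_graph H ?N" using c by (simp add: contains_class_def)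
  then show "contains_graph H G" using contains_graph_trans[OF G(1) N H GN] by blast
qed

end

theory Submission
  imports Defs "HOL-Combinatorics.Permutations" Complex_Main
begin

text \<open>
  The witness is a ray on the natural numbers whose block \<open>[2n, 4n)\<close>, for every \<open>n = 2 ^ k\<close>, carries
  in addition a perfect matching between its two halves, given by a permutation of \<open>{..<n}\<close>.
  If all degrees of the host are at most \<open>\<Delta>\<close>, then the copies of the first \<open>4n\<close> vertices that start
  at a given host vertex, together with the images of the matching edges, can be described by \<open>5n\<close>
  choices among \<open>\<Delta>\<close> neighbours. Hence at most \<open>\<Delta> ^ (5n) < n!\<close> permutations of the block occur, and
  some permutation is impossible for that start vertex. Since the host has only countably many
  vertices, each of them can be ruled out as the start of the ray by a block of its own.
\<close>

definition matched_ray :: "(nat \<Rightarrow> nat \<Rightarrow> nat) \<Rightarrow> nat graph" where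
  "matched_ray \<sigma> = \<lparr>verts = UNIV,
     edges = {{i, Suc i} | i. True} \<union> {{2 * 2 ^ k + i, 3 * 2 ^ k + \<sigma> k i} | k i. i < 2 ^ k}\<rparr>"

text \<open>Directed from the lower to the upper half of a block; matching partners are therefore
  described by a disjunction over both argument orders.\<close>

definition chord :: "(nat \<Rightarrow> nat \<Rightarrow> nat) \<Rightarrow> nat \<Rightarrow> nat \<Rightarrow> bool" where
  "chord \<sigma> u v \<longleftrightarrow> (\<exists>k i. i < 2 ^ k \<and> u = 2 * 2 ^ k + i \<and> v = 3 * 2 ^ k + \<sigma> k i)"

lemma verts_matched_ray [simp]: "verts (matched_ray \<sigma>) = UNIV"
  by (simp add: matched_ray_def)

lemma adjacent_matched_ray:
  "adjacent (matched_ray \<sigma>) u v \<longleftrightarrow> v = Suc u \<or> u = Suc v \<or> chord \<sigma> u v \<or> chord \<sigma> v u"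
  unfolding adjacent_def matched_ray_def chord_def by (auto simp: doubleton_eq_iff)

lemma dyadic_block_unique:
  fixes k l x :: nat
  assumes "2 ^ k \<le> x" "x < 2 * 2 ^ k" "2 ^ l \<le> x" "x < 2 * 2 ^ l"
  shows "k = l"
proof -
  have "(2::nat) ^ k < 2 ^ Suc l" "(2::nat) ^ l < 2 ^ Suc k" using assms by auto
  then have "k < Suc l" "l < Suc k" by (metis one_less_numeral_iff power_less_imp_less_exp semiring_norm(76))+
  then show ?thesis by simp
qed

text \<open>Blocks for different \<open>k\<close> are disjoint, so \<open>v\<close> fixes
  \<open>k\<close>. Within its block \<open>v\<close> lies in only one half: in the lower half it
  fixes the index \<open>i\<close> directly, in the upper half through injectivity of
  \<open>\<sigma> k\<close>.\<close>

lemma chord_unique: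
  assumes perm: "\<And>k. \<sigma> k permutes {..<2 ^ k}"
    and u: "chord \<sigma> v u \<or> chord \<sigma> u v" and w: "chord \<sigma> v w \<or> chord \<sigma> w v"
  shows "u = w"
proof -
  have \<sigma>: "\<sigma> k i < 2 ^ k" if "i < 2 ^ k" for k i
    using permutes_in_image[OF perm[of k], of i] that by simp
  have split: "\<exists>k i. i < 2 ^ k \<and>
      (v = 2 * 2 ^ k + i \<and> x = 3 * 2 ^ k + \<sigma> k i \<or> x = 2 * 2 ^ k + i \<and> v = 3 * 2 ^ k + \<sigma> k i)"
    if "chord \<sigma> v x \<or> chord \<sigma> x v" for x
    using that unfolding chord_def by blast
  obtain k i where k: "i < 2 ^ k"
      "v = 2 * 2 ^ k + i \<and> u = 3 * 2 ^ k + \<sigma> k i \<or> u = 2 * 2 ^ k + i \<and> v = 3 * 2 ^ k + \<sigma> k i"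
    using split[OF u] by blast
  obtain l j where l: "j < 2 ^ l"
      "v = 2 * 2 ^ l + j \<and> w = 3 * 2 ^ l + \<sigma> l j \<or> w = 2 * 2 ^ l + j \<and> v = 3 * 2 ^ l + \<sigma> l j"
    using split[OF w] by blast
  \<comment> \<open>The block of index \<open>k\<close> is the dyadic interval from
    \<open>2 ^ Suc k\<close> to \<open>2 * 2 ^ Suc k\<close>, hence the shifted exponents.\<close>
  have "Suc k = Suc l"
    by (rule dyadic_block_unique[of _ v]) (use k l \<sigma>[OF k(1)] \<sigma>[OF l(1)] in auto)
  then have [simp]: "l = k" by simp
  have "\<sigma> k i = \<sigma> k j \<Longrightarrow> i = j" using permutes_inj[OF perm[of k]] by (simp add: inj_eq)
  then show ?thesis using k l \<sigma>[OF k(1)] \<sigma>[of j k] by auto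
qed

lemma matched_ray_in_G4:
  assumes perm: "\<And>k. \<sigma> k permutes {..<2 ^ k}"
  shows "matched_ray \<sigma> \<in> G4"
proof -
  let ?G = "matched_ray \<sigma>"
  have "simple_graph ?G"
  proof -
    have "2 * 2 ^ k + i \<noteq> 3 * 2 ^ k + \<sigma> k i" if "i < 2 ^ k" for k i :: nat
      using that by linarith
    then show ?thesis by (auto simp: simple_graph_def matched_ray_def card_insert_if)
  qed
  moreover have "connected_graph ?G"
  proof -
    \<comment> \<open>Both directions are built together, so that any two vertices can be joined
      through 0.\<close>
    have "(adjacent ?G)\<^sup>*\<^sup>* 0 v \<and> (adjacent ?G)\<^sup>*\<^sup>* v 0" for v
    proof (induction v)
      case (Suc v)
      then show ?case
        by (meson adjacent_matched_ray converse_rtranclp_into_rtranclp rtranclp.rtrancl_into_rtrancl)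
    qed simp
    then show ?thesis unfolding connected_graph_def by (auto intro: rtranclp_trans)
  qed
  moreover have "degree ?G v < enat 4" for v
  proof -
    let ?C = "{u. chord \<sigma> v u \<or> chord \<sigma> u v}"
    have "\<exists>c. ?C \<subseteq> {c}"
      using chord_unique[OF perm] by (metis (mono_tags, lifting) mem_Collect_eq singleton_iff subsetI)
    then obtain c where c: "?C \<subseteq> {c}" by blast
    \<comment> \<open>For \<open>v = 0\<close> the truncated \<open>v - 1\<close> is 0 itself, and
      for an unmatched \<open>v\<close> the element \<open>c\<close> is arbitrary; both are harmless
      in an upper bound.\<close>
    have sub: "neighbours ?G v \<subseteq> {v - 1, Suc v, c}"
      using c by (auto simp: neighbours_def adjacent_matched_ray)
    have "card (neighbours ?G v) \<le> card {v - 1, Suc v, c}" by (rule card_mono[OF _ sub]) simp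
    also have "\<dots> \<le> 3" by (simp add: card_insert_if)
    finally show ?thesis using finite_subset[OF sub] by (simp add: degree_def)
  qed
  ultimately show ?thesis
    by (simp add: G4_def star_free_graphs_iff countable_graph_def)
qed

text \<open>The terms of the exponential series at \<open>c\<close> tend to 0, so they are
  eventually below 1.\<close>

lemma eventually_power_less_fact:
  fixes c :: nat
  shows "eventually (\<lambda>n. c ^ n < fact n) sequentially"
proof -
  have "(\<lambda>n. inverse (fact n) * real c ^ n) \<longlonglongrightarrow> 0"
    by (rule summable_LIMSEQ_zero[OF summable_exp])
  then have "eventually (\<lambda>n. inverse (fact n) * real c ^ n < 1) sequentially"
    by (rule order_tendstoD) simp
  then show ?thesis
  proof eventually_elim
    case (elim n)
    then have "real (c ^ n) < real (fact n)" by (simp add: field_simps)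
    then show ?case by (simp only: of_nat_less_iff)
  qed
qed

text \<open>A single \<open>e\<close> for all vertices turns each step along an edge into a letter
  below \<Delta>, so that walks from a fixed vertex become words. Values of \<open>e u\<close> at
  surplus letters are arbitrary.\<close>

lemma bounded_degree_enumeration:
  assumes "simple_graph H" and "\<And>v. v \<in> verts H \<Longrightarrow> degree H v \<le> enat \<Delta>"
  obtains e :: "'a \<Rightarrow> nat \<Rightarrow> 'a" where "\<And>u v. adjacent H u v \<Longrightarrow> \<exists>c<\<Delta>. v = e u c"
proof -
  have "\<exists>g. \<forall>v. adjacent H u v \<longrightarrow> (\<exists>c<\<Delta>. v = g c)" for u :: 'a
  proof (cases "u \<in> verts H")
    case True
    then have fin: "finite (neighbours H u)" and le: "card (neighbours H u) \<le> \<Delta>"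
      using assms(2)[OF True] by (auto simp: degree_def split: if_splits)
    obtain g where g: "bij_betw g {0..<card (neighbours H u)} (neighbours H u)"
      using ex_bij_betw_nat_finite[OF fin] by blast
    have "\<exists>c<\<Delta>. v = g c" if "adjacent H u v" for v
    proof -
      have "v \<in> g ` {0..<card (neighbours H u)}"
        using g that by (simp add: bij_betw_def neighbours_def)
      then show ?thesis using le by (meson atLeastLessThan_iff imageE less_le_trans)
    qed
    then show ?thesis by blast
  next
    case False
    then show ?thesis using adjacent_verts[OF assms(1)] by blast
  qed
  then obtain e where "\<forall>u v. adjacent H u v \<longrightarrow> (\<exists>c<\<Delta>. v = e u c)" by metis
  then show ?thesis using that by blast
qed

text \<open>Only the chords of one block are demanded. Whether \<pi> is excluded for
  \<open>v\<close> is thus independent of the other blocks, whose permutations can be chosen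
  separately.\<close>

definition realizable :: "'a graph \<Rightarrow> 'a \<Rightarrow> nat \<Rightarrow> (nat \<Rightarrow> nat) \<Rightarrow> bool" where
  "realizable H v n \<pi> \<longleftrightarrow> (\<exists>f :: nat \<Rightarrow> 'a. inj f \<and> f 0 = v \<and> (\<forall>i. adjacent H (f i) (f (Suc i))) \<and>
     (\<forall>i<n. adjacent H (f (2 * n + i)) (f (3 * n + \<pi> i))))"

lemma card_realizable_le:
  assumes e: "\<And>u v. adjacent H u v \<Longrightarrow> \<exists>c<\<Delta>. v = e u c"
  shows "card {\<pi>. \<pi> permutes {..<n} \<and> realizable H v n \<pi>} \<le> \<Delta> ^ (5 * n)"
proof -
  define R where "R = {\<pi>. \<pi> permutes {..<n} \<and> realizable H v n \<pi>}"
  define L where "L = {xs. set xs \<subseteq> {..<\<Delta>} \<and> length xs = 5 * n}"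
  \<comment> \<open>The first \<open>4 * n\<close> letters trace the ray from \<open>v\<close>, the
    last \<open>n\<close> the chords. This is a relation because several \<open>f\<close> may
    realize the same \<pi>.\<close>
  define codes where "codes \<pi> xs \<longleftrightarrow> (\<exists>f. inj f \<and> f 0 = v \<and>
      (\<forall>i<4 * n. f (Suc i) = e (f i) (xs ! i)) \<and>
      (\<forall>i<n. f (3 * n + \<pi> i) = e (f (2 * n + i)) (xs ! (4 * n + i))))" for \<pi> :: "nat \<Rightarrow> nat" and xs
  have "finite L" "card L = \<Delta> ^ (5 * n)"
    unfolding L_def by (simp_all add: finite_lists_length_eq card_lists_length_eq)
  moreover have "\<exists>xs. xs \<in> L \<and> codes \<pi> xs" if "\<pi> \<in> R" for \<pi>
  proof -
    obtain f where f: "inj f" "f 0 = v" "\<And>i. adjacent H (f i) (f (Suc i))"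
        "\<And>i. i < n \<Longrightarrow> adjacent H (f (2 * n + i)) (f (3 * n + \<pi> i))"
      using \<open>\<pi> \<in> R\<close> unfolding R_def realizable_def by blast
    obtain c where c: "\<And>i. c i < \<Delta> \<and> f (Suc i) = e (f i) (c i)"
      using e[OF f(3)] by metis
    obtain d where d: "\<And>i. i < n \<Longrightarrow> d i < \<Delta> \<and> f (3 * n + \<pi> i) = e (f (2 * n + i)) (d i)"
      using e[OF f(4)] by metis
    let ?xs = "map c [0..<4 * n] @ map d [0..<n]"
    have "?xs \<in> L" using c d by (auto simp: L_def)
    moreover have "codes \<pi> ?xs"
      unfolding codes_def using f(1,2) c d by (intro exI[of _ f]) (simp add: nth_append)
    ultimately show ?thesis by blast
  qed
  moreover have "\<pi> = \<rho>" if \<pi>: "\<pi> \<in> R" "codes \<pi> xs" and \<rho>: "\<rho> \<in> R" "codes \<rho> xs" for \<pi> \<rho> xs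
  proof -
    obtain f where f: "inj f" "f 0 = v" "\<And>i. i < 4 * n \<Longrightarrow> f (Suc i) = e (f i) (xs ! i)"
        "\<And>i. i < n \<Longrightarrow> f (3 * n + \<pi> i) = e (f (2 * n + i)) (xs ! (4 * n + i))"
      using \<pi>(2) unfolding codes_def by blast
    obtain g where g: "g 0 = v" "\<And>i. i < 4 * n \<Longrightarrow> g (Suc i) = e (g i) (xs ! i)"
        "\<And>i. i < n \<Longrightarrow> g (3 * n + \<rho> i) = e (g (2 * n + i)) (xs ! (4 * n + i))"
      using \<rho>(2) unfolding codes_def by blast
    \<comment> \<open>Both maps obey the same recursion from \<open>v\<close>, so the word
      determines the ray up to \<open>4 * n\<close>.\<close>
    have fg: "f i = g i" if "i \<le> 4 * n" for i
      using that by (induction i) (simp_all add: f(2,3) g(1,2))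
    have perm: "\<pi> permutes {..<n}" "\<rho> permutes {..<n}" using \<pi> \<rho> by (simp_all add: R_def)
    show ?thesis
    proof (rule ext)
      fix i show "\<pi> i = \<rho> i"
      proof (cases "i < n")
        case True
        then have "\<rho> i < n" using permutes_in_image[OF perm(2), of i] by simp
        \<comment> \<open>Letter \<open>4 * n + i\<close> leads from the common vertex at
          \<open>2 * n + i\<close> to the same endpoint for \<open>f\<close> and \<open>g\<close>;
          since \<open>3 * n + \<rho> i\<close> is below \<open>4 * n\<close>, \<open>g\<close> can
          be replaced by \<open>f\<close> there.\<close>
        then have "f (3 * n + \<pi> i) = f (3 * n + \<rho> i)"
          using f(4) g(3) fg[of "2 * n + i"] fg[of "3 * n + \<rho> i"] True by simp
        then show ?thesis using f(1) by (simp add: inj_eq)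
      next
        case False
        then show ?thesis using perm by (simp add: permutes_not_in)
      qed
    qed
  qed
  ultimately show ?thesis
    unfolding R_def[symmetric] by (metis card_le_if_inj_on_rel)
qed

lemma ex_unrealizable_permutation:
  fixes \<Delta> :: nat
  assumes "\<And>u v. adjacent H u v \<Longrightarrow> \<exists>c<\<Delta>. v = e u c" and "\<Delta> ^ (5 * n) < fact n"
  shows "\<exists>\<pi>. \<pi> permutes {..<n} \<and> \<not> realizable H v n \<pi>"
proof (rule ccontr)
  assume "\<not> ?thesis"
  then have "{\<pi>. \<pi> permutes {..<n} \<and> realizable H v n \<pi>} = {\<pi>. \<pi> permutes {..<n}}" by blast
  then have "fact n \<le> \<Delta> ^ (5 * n)"
    using card_realizable_le[of H \<Delta> e n v, OF assms(1)] card_permutations[of "{..<n}" n] by simp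
  then show False using assms(2) by simp
qed

theorem theorem1p2:
  fixes H :: "'a graph"
  assumes "simple_graph H" and "connected_graph H" and "countable_graph H"
    and "contains_class H G4"
  shows "\<not> (\<exists>\<Delta>::nat. \<forall>v\<in>verts H. degree H v \<le> enat \<Delta>)"
proof
  assume "\<exists>\<Delta>::nat. \<forall>v\<in>verts H. degree H v \<le> enat \<Delta>"
  then obtain \<Delta> where \<Delta>: "\<And>v. v \<in> verts H \<Longrightarrow> degree H v \<le> enat \<Delta>" by blast
  obtain e where e: "\<And>u v. adjacent H u v \<Longrightarrow> \<exists>c<\<Delta>. v = e u c"
    using bounded_degree_enumeration[OF assms(1) \<Delta>] by blast
  \<comment> \<open>The base is \<open>\<Delta> ^ 5\<close> because the bound on realizable
    permutations is \<open>\<Delta> ^ (5 * n)\<close>.\<close>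
  obtain N where N: "\<And>n. n \<ge> N \<Longrightarrow> (\<Delta> ^ 5) ^ n < fact n"
    using eventually_power_less_fact[of "\<Delta> ^ 5"] unfolding eventually_sequentially by blast
  \<comment> \<open>Block \<open>k\<close> is responsible for ruling out the start vertex
    \<open>?w k\<close>. Blocks below \<open>N\<close> are too short for the count and stay
    unconstrained; the shift by \<open>N\<close> still lets every vertex be listed.\<close>
  let ?w = "\<lambda>k. from_nat_into (verts H) (k - N)"
  have "\<exists>\<pi>. \<pi> permutes {..<2 ^ k} \<and> (N \<le> k \<longrightarrow> \<not> realizable H (?w k) (2 ^ k) \<pi>)" for k
  proof (cases "N \<le> k")
    case True
    then have "N \<le> 2 ^ k" using less_exp[of k] by linarith
    then have "\<Delta> ^ (5 * 2 ^ k) < fact (2 ^ k)" using N by (simp add: power_mult)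
    then show ?thesis using ex_unrealizable_permutation[of H \<Delta> e, OF e] by blast
  qed (use permutes_id in blast)
  then obtain \<sigma> where \<sigma>: "\<And>k. \<sigma> k permutes {..<2 ^ k}"
      "\<And>k. N \<le> k \<Longrightarrow> \<not> realizable H (?w k) (2 ^ k) (\<sigma> k)" by metis
  have G: "matched_ray \<sigma> \<in> G4" using \<sigma>(1) by (rule matched_ray_in_G4)
  then have "simple_graph (matched_ray \<sigma>)" "contains_graph H (matched_ray \<sigma>)"
    using assms(4) by (auto simp: contains_class_def G4_def star_free_graphs_def)
  then obtain f where f: "inj f" "range f \<subseteq> verts H"
      "\<And>u v. adjacent (matched_ray \<sigma>) u v \<Longrightarrow> adjacent H (f u) (f v)"
    by (metis contains_graphE verts_matched_ray)
  have "\<exists>j. f 0 = from_nat_into (verts H) j"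
    using f(2) assms(3) from_nat_into_surj[of "verts H" "f 0"]
    by (metis countable_graph_def range_subsetD)
  then obtain j where j: "f 0 = from_nat_into (verts H) j" by blast
  \<comment> \<open>The embedding itself realizes the permutation of the block that was chosen to
    exclude its start vertex \<open>f 0\<close>.\<close>
  have "realizable H (?w (N + j)) (2 ^ (N + j)) (\<sigma> (N + j))"
    unfolding realizable_def
  proof (intro exI[of _ f] conjI allI impI f(3))
    fix i :: nat assume "i < 2 ^ (N + j)"
    then show "adjacent (matched_ray \<sigma>) (2 * 2 ^ (N + j) + i) (3 * 2 ^ (N + j) + \<sigma> (N + j) i)"
      by (auto simp: adjacent_matched_ray chord_def)
  qed (use f(1) j in \<open>auto simp: adjacent_matched_ray\<close>)
  then show False using \<sigma>(2)[of "N + j"] by simp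
qed

end
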